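(* Consider the relaxed spatial-domain minimum time and fuel problem (the relaxed problem) defined in the context, and let $b^*,\Delta E_{\mathrm{batt}}^*$ (states) and $F_D^*,F_H^*,F_R^*,y_t^*,D_R^*,z^*,\tilde n_p^*,F_c^*,F_{\mathrm{batt}}^*$ (inputs) be an optimal solution of it. Write $T_p^*,Q_p^*,F_{\Delta E_p}^*,F_{\mathrm{batt,d}}^*$ for the values of the corresponding expressions at this solution. Suppose that the propeller parameters satisfy $$1<\frac{a_{Q,1}\,a_{T,0}}{a_{Q,0}\,a_{T,1}}-\frac{a_{Q,2}\,a_{T,0}^2}{a_{Q,0}\,a_{T,1}^2},$$ and that for each $\sigma\in[0,1]$ the optimal solution satisfies: (1) the battery dissipation power satisfies $P_{\mathrm{batt,d}}(P_{\mathrm{batt}}^* )\le P_{\mathrm{aux}}$, where $P_{\mathrm{batt,d}}(P)=\frac{R_i}{U_0^2}P^2$ and $P_{\mathrm{batt}}^*=F_{\mathrm{batt}}^*/y_t^*$; (2) the electric machine operates strictly below its maximum speed: $i_g\sqrt{\tilde n_p^*}<n_{\mathrm{EM,max}}$; (3) the electric machine operates strictly below its maximum torque: $\frac{Q_p^*}{\eta_g i_g}<Q_{\mathrm{EM,max}}$; (4) the converters deliver positive output power: $F_c^*>0$. Then the three relaxed inequalities hold with equality at the optimum, i.e. for $\sigma\in[0,1]$, $$y_t^*=\frac{1}{\sqrt{b^*}},\qquad z^*=\sqrt{s'_{12}\,b^*\,\tilde n_p^*},$$ $$k_c F_c^*+F_{\mathrm{batt}}^*\,\eta_{\mathrm{DC/DC,batt}}=k_p\frac{F_{\Delta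 E_p}^*}{\tilde\eta_{\mathrm{EM}}}+P_{\mathrm{aux}}\,y_t^*+F_{\mathrm{batt,d}}^*.$$
   Context: **Path.** A sufficiently smooth path $s=(s_1,s_2,s_3):[0,1]\to\mathbb{R}^3$ is given, with path coordinate $\sigma\in[0,1]$. Here $(s_1,s_2)$ is the planar position of a vessel and $s_3=\theta$ its orientation. A prime denotes $d/d\sigma$, and $s'_{12}:=(s_1')^2+(s_2')^2$. The state $b(\sigma)>0$ stands for $\dot\sigma^2$, so the vessel speed is $v_s=\sqrt{s'_{12}b}$. All states and inputs are functions of $\sigma$. **States and inputs.** The states are $b$ and $\Delta E_{\mathrm{batt}}$ (change in battery energy). The inputs are: - $F_D$ (hull drag), $F_H$ (drift force), $F_R$ (rudder force), $D_R$ (rudder drag); - $y_t>0$ (auxiliary variable for $dt/d\sigma=1/\sqrt b$); - $z>0$ (auxiliary variable for $v_s n_p$, with $n_p$ the propeller shaft speed) and $\tilde n_p$ (auxiliary variable for $n_p^2$); - $F_c$ (energy converter output energy per unit $\sigma$) and $F_{\mathrm{batt}}$ (battery output energy per unit $\sigma$). **Propeller.** The thrust and torque coefficients as functions of the advance coefficient $J$ are modeled as $K_T(J)=-a_{T,2}J^2-a_{T,1}J+a_{T,0}$ and $K_Q(J)=-a_{Q,2}J^2-a_{Q,1}J+a_{Q,0}$, with $a_{T,2},a_{T,1},a_{Q,2},a_{Q,1}\ge 0$ and $a_{T,0},a_{Q,0}>0$. With water density $\rho$, propeller diameter $D_p$ and wake fraction $f_w$: - $T_p=-\tilde a_{T,2}s'_{12}b-\tilde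 a_{T,1}z+\tilde a_{T,0}\tilde n_p$, where $\tilde a_{T,2}=a_{T,2}\rho D_p^2(1-f_w)^2$, $\tilde a_{T,1}=a_{T,1}\rho D_p^3(1-f_w)$, $\tilde a_{T,0}=a_{T,0}\rho D_p^4$; - $Q_p=-\tilde a_{Q,2}s'_{12}b-\tilde a_{Q,1}z+\tilde a_{Q,0}\tilde n_p$, where $\tilde a_{Q,2}=a_{Q,2}\rho D_p^3(1-f_w)^2$, $\tilde a_{Q,1}=a_{Q,1}\rho D_p^4(1-f_w)$, $\tilde a_{Q,0}=a_{Q,0}\rho D_p^5$; - $F_{\Delta E_p}=-k_2z-k_1\tilde n_p+k_0\tilde n_p^2/z$ (propeller input energy per unit $\sigma$), where $k_2=2\pi\rho D_p^3a_{Q,2}(1-f_w)^2$, $k_1=2\pi\rho D_p^4a_{Q,1}(1-f_w)$, $k_0=2\pi\rho D_p^5a_{Q,0}$. **Other expressions.** - Yaw damping force: $F_P=x_T\frac{\pi}{2}\rho T_d^2\,s_3'\sqrt{s'_{12}}\,b$, with stern coordinate $x_T$ and draft $T_d$. - Battery loss: $F_{\mathrm{batt,d}}=\frac{R_i}{U_0^2}\frac{F_{\mathrm{batt}}^2}{y_t}$, with internal resistance $R_i$ and open circuit voltage $U_0$. - Electric machine input: $F_{\mathrm{EM}}=F_{\Delta E_p}/\tilde\eta_{\mathrm{EM}}$, with $\tilde\eta_{\mathrm{EM}}=\eta_{\mathrm{EM}}\eta_g$ the product of the machine and gearbox efficiencies. - For a maximum power $P_{\max}$, the linearized force limit around a reference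 speed $v_r>0$ is $\Phi(P_{\max},b)=\frac{P_{\max}}{2}\frac{\sqrt{s'_{12}}}{v_r}\left(3-\frac{s'_{12}b}{v_r^2}\right)$. **Given data.** $k_c(\sigma)\in\mathbb{N}$ is the number of converters turned on (fixed in advance) and $k_p$ the number of propellers. $P_{\mathrm{aux}}$ is the constant auxiliary load. $a_{c,0},a_{c,1}>0$ are converter loss coefficients and $\omega_T>0$ is the weight on time. $i_g$ is the gearbox ratio. $\eta_{\mathrm{DC/DC,batt}}$ is the battery converter efficiency. The matrix $M=\mathrm{diag}(m(1+k_1^{add}),m(1+k_1^{add}),I_0+k_2^{add}I_w)$ collects mass, inertia and added inertia. $\tau$ is a given disturbance force depending on $s(\sigma)$. $L_H,L_P,L_R$ are lever arms. $S,A_s,\Omega,A_R,\Lambda,k_{tm},C_{L,\max},C_K(\omega_{\max})$ are given positive geometric/lift constants ($S$ lifting area, $A_s$ wetted area, $\Omega$ hull aspect ratio, $A_R$ rudder area, $\Lambda$ rudder aspect ratio, $k_{tm}$ a turbulent-mixing factor, and maximal hull and rudder lift coefficients). $C_F,C_R$ are given frictional and residual resistance coefficients (possibly depending on $v_s$). $n_{\mathrm{EM,max}},Q_{\mathrm{EM,max}},P_{\mathrm{EM,max}},P_{c,\max},P_{\mathrm{cha,max}},P_{\mathrm{dis,max}},\Delta E_{\min},\Delta E_{\max}$ are given limits, and $v_{\mathrm{init}},v_{\mathrm{final}}$ are given speeds. The rotation matrix is $$R=\begin{bmatrix}\cos\theta&-\cos\theta&-\sin\theta&-\sin\theta&\sin\theta\\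 \sin\theta&-\sin\theta&\cos\theta&\cos\theta&-\cos\theta\\0&0&L_H&-L_P&L_R\end{bmatrix},\quad\theta=s_3(\sigma).$$ **Relaxed problem.** Minimize $$\int_0^1\left[(k_ca_{c,0}+\omega_T)y_t+k_ca_{c,1}F_c\right]d\sigma$$ subject to, for each $\sigma\in[0,1]$: - dynamics: $R\,(T_p,\,F_D+D_R,\,F_H,\,F_P,\,F_R)^\top=M\left[s'\frac{b'}{2}+s''b\right]+\tau$ and $\Delta E_{\mathrm{batt}}'=-F_{\mathrm{batt}}\sqrt{s'_{12}}$; - drift limit: $|F_H|\le\frac{\rho}{2}SC_{L,\max}s'_{12}b$; - drag: $\frac{\rho}{2}(C_F+C_R)A_ss'_{12}b+\frac{2F_H^2A_s}{\rho\pi\Omega S^2s'_{12}b}\le F_D$; - rudder: with $w=(1-f_w)^2s'_{12}b+\frac{T_p}{\frac{\rho}{2}\frac{\pi}{4}D_p^2}$, $|F_R|\le\frac{\rho}{2}C_K(\omega_{\max})A_Rk_{tm}^2w$ and $D_R\ge\frac{2.2F_R^2}{A_R\pi\Lambda\rho k_{tm}^2w}$; - relaxed speed product: $z\le\sqrt{s'_{12}b\,\tilde n_p}$; - relaxed inverse speed: $\frac{1}{\sqrt b}\le y_t$; - relaxed energy (force) balance: $k_p\frac{F_{\Delta E_p}}{\tilde\eta_{\mathrm{EM}}}+P_{\mathrm{aux}}y_t+F_{\mathrm{batt,d}}\le k_cF_c+F_{\mathrm{batt}}\eta_{\mathrm{DC/DC,batt}}$; - machine limits: $\tilde n_p\le(n_{\mathrm{EM,max}}/i_g)^2$,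 $Q_p\le Q_{\mathrm{EM,max}}\eta_gi_g$, $F_{\mathrm{EM}}\le\Phi(P_{\mathrm{EM,max}},b)$; - converter limits: $0\le F_c\le\Phi(P_{c,\max},b)$; - battery limits: $\Delta E_{\min}\le\Delta E_{\mathrm{batt}}\le\Delta E_{\max}$ and $-\Phi(P_{\mathrm{cha,max}},b)\le F_{\mathrm{batt}}\le\Phi(P_{\mathrm{dis,max}},b)$; and the boundary conditions $b(0)=v_{\mathrm{init}}^2/s'_{12}(0)$, $b(1)=v_{\mathrm{final}}^2/s'_{12}(1)$, $\Delta E_{\mathrm{batt}}(0)=\Delta E_{\mathrm{batt}}(1)$.
   Formalization: Added, since the claim is false without it: wherever (1) holds with equality and P_aux>0, the converter is strictly below its power limit, F_c*<Φ(P_c,max,b* ). Inputs are taken piecewise continuous (normalised at jumps), and k_c, k_p are at least 1. *)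

theory Defs
  imports "HOL-Analysis.Analysis"
begin

text \<open>
  Piecewise continuous functions on \<open>[0,1]\<close>: finitely many discontinuities, all of them
  jumps.  The value at a jump is the right limit, and the value at \<open>1\<close> is the left limit; without
  such a normalisation an input could be changed at single points without affecting
  the problem, and pointwise statements about an optimal input would be meaningless.
\<close>

definition pw_continuous :: "(real \<Rightarrow> real) \<Rightarrow> bool" where
  "pw_continuous f \<longleftrightarrow>
     (\<exists>D. finite D \<and> continuous_on ({0..1} - D) f) \<and>
     (\<forall>t\<in>{0..<1}. (f \<longlongrightarrow> f t) (at_right t)) \<and>
     (\<forall>t\<in>{0<..1}. \<exists>l. (f \<longlongrightarrow> l) (at_left t)) \<and>
     (f \<longlongrightarrow> f 1) (at_left 1)"

text \<open>
  Continuous functions with a piecewise continuous derivative.  At a kink the derivative is the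
  right one, so that state equations driven by piecewise continuous inputs can be required at
  every point of \<open>[0,1]\<close>.
\<close>

definition has_pw_derivative :: "(real \<Rightarrow> real) \<Rightarrow> (real \<Rightarrow> real) \<Rightarrow> bool" where
  "has_pw_derivative f f' \<longleftrightarrow>
     continuous_on {0..1} f \<and> pw_continuous f' \<and>
     (\<forall>t\<in>{0..<1}. (f has_real_derivative f' t) (at_right t)) \<and>
     (f has_real_derivative f' 1) (at_left 1)"

record vessel =
  s_path :: "real \<Rightarrow> real^3"
  \<comment> \<open>propeller\<close>
  a_T2 :: real  a_T1 :: real  a_T0 :: real
  a_Q2 :: real  a_Q1 :: real  a_Q0 :: real
  rho :: real  D_p :: real  f_w :: real
  k_p :: nat
  \<comment> \<open>hull and rudder\<close>
  x_T :: real  T_d :: real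
  S_lift :: real  A_s :: real  Omega :: real
  A_R :: real  Lambda :: real  k_tm :: real
  C_Lmax :: real
  C_K :: "real \<Rightarrow> real"
  omega_max :: real
  \<comment> \<open>resistance coefficients as functions of the vessel speed\<close>
  C_F :: "real \<Rightarrow> real"
  C_R :: "real \<Rightarrow> real"
  \<comment> \<open>rigid body, lever arms, disturbance force as a function of the pose\<close>
  mass :: real  I_0 :: real  I_w :: real
  k1_add :: real  k2_add :: real
  L_H :: real  L_P :: real  L_R :: real
  tau :: "real^3 \<Rightarrow> real^3"
  \<comment> \<open>powertrain\<close>
  R_i :: real  U_0 :: real  eta_DCDC :: real
  eta_EM :: real  eta_g :: real  i_g :: real
  P_aux :: real
  k_c :: "real \<Rightarrow> nat"
  a_c0 :: real  a_c1 :: real  omega_T :: real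
  \<comment> \<open>reference speed of the linearised power limits, limits, boundary speeds\<close>
  v_r :: real
  n_EMmax :: real  Q_EMmax :: real  P_EMmax :: real
  P_cmax :: real  P_chamax :: real  P_dismax :: real
  dE_min :: real  dE_max :: real
  v_init :: real  v_final :: real

text \<open>States and inputs as functions of the path coordinate; \<open>tr_n\<close> stands for the squared shaft speed.\<close>

record trajectory =
  tr_b :: "real \<Rightarrow> real"
  tr_dE :: "real \<Rightarrow> real"
  tr_FD :: "real \<Rightarrow> real"
  tr_FH :: "real \<Rightarrow> real"
  tr_FR :: "real \<Rightarrow> real"
  tr_y :: "real \<Rightarrow> real"
  tr_DR :: "real \<Rightarrow> real"
  tr_z :: "real \<Rightarrow> real"
  tr_n :: "real \<Rightarrow> real"
  tr_Fc :: "real \<Rightarrow> real"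
  tr_Fb :: "real \<Rightarrow> real"

definition dpath :: "vessel \<Rightarrow> real \<Rightarrow> real^3" where
  "dpath p t = vector_derivative (s_path p) (at t within {0..1})"

definition ddpath :: "vessel \<Rightarrow> real \<Rightarrow> real^3" where
  "ddpath p t = vector_derivative (dpath p) (at t within {0..1})"

definition s12 :: "vessel \<Rightarrow> real \<Rightarrow> real" where
  "s12 p t = (dpath p t $ 1)\<^sup>2 + (dpath p t $ 2)\<^sup>2"

definition smooth_path :: "vessel \<Rightarrow> bool" where
  "smooth_path p \<longleftrightarrow>
     (\<forall>t\<in>{0..1}. s_path p differentiable (at t within {0..1})) \<and>
     (\<forall>t\<in>{0..1}. dpath p differentiable (at t within {0..1})) \<and>
     continuous_on {0..1} (ddpath p)"

definition T_p :: "vessel \<Rightarrow> trajectory \<Rightarrow> real \<Rightarrow> real" where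
  "T_p p x t =
     - (a_T2 p * rho p * D_p p ^ 2 * (1 - f_w p) ^ 2) * s12 p t * tr_b x t
     - (a_T1 p * rho p * D_p p ^ 3 * (1 - f_w p)) * tr_z x t
     + (a_T0 p * rho p * D_p p ^ 4) * tr_n x t"

definition Q_p :: "vessel \<Rightarrow> trajectory \<Rightarrow> real \<Rightarrow> real" where
  "Q_p p x t =
     - (a_Q2 p * rho p * D_p p ^ 3 * (1 - f_w p) ^ 2) * s12 p t * tr_b x t
     - (a_Q1 p * rho p * D_p p ^ 4 * (1 - f_w p)) * tr_z x t
     + (a_Q0 p * rho p * D_p p ^ 5) * tr_n x t"

definition F_dEp :: "vessel \<Rightarrow> trajectory \<Rightarrow> real \<Rightarrow> real" where
  "F_dEp p x t =
     - (2 * pi * rho p * D_p p ^ 3 * a_Q2 p * (1 - f_w p) ^ 2) * tr_z x t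
     - (2 * pi * rho p * D_p p ^ 4 * a_Q1 p * (1 - f_w p)) * tr_n x t
     + (2 * pi * rho p * D_p p ^ 5 * a_Q0 p) * (tr_n x t)\<^sup>2 / tr_z x t"

definition F_P :: "vessel \<Rightarrow> trajectory \<Rightarrow> real \<Rightarrow> real" where
  "F_P p x t = x_T p * (pi / 2) * rho p * (T_d p)\<^sup>2 * (dpath p t $ 3) * sqrt (s12 p t) * tr_b x t"

definition F_battd :: "vessel \<Rightarrow> trajectory \<Rightarrow> real \<Rightarrow> real" where
  "F_battd p x t = R_i p / (U_0 p)\<^sup>2 * ((tr_Fb x t)\<^sup>2 / tr_y x t)"

definition P_battd :: "vessel \<Rightarrow> real \<Rightarrow> real" where
  "P_battd p P = R_i p / (U_0 p)\<^sup>2 * P\<^sup>2"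

definition eta_EM_tilde :: "vessel \<Rightarrow> real" where
  "eta_EM_tilde p = eta_EM p * eta_g p"

definition F_EM :: "vessel \<Rightarrow> trajectory \<Rightarrow> real \<Rightarrow> real" where
  "F_EM p x t = F_dEp p x t / eta_EM_tilde p"

definition Phi :: "vessel \<Rightarrow> real \<Rightarrow> trajectory \<Rightarrow> real \<Rightarrow> real" where
  "Phi p Pmax x t =
     Pmax / 2 * (sqrt (s12 p t) / v_r p) * (3 - s12 p t * tr_b x t / (v_r p)\<^sup>2)"

definition v_s :: "vessel \<Rightarrow> trajectory \<Rightarrow> real \<Rightarrow> real" where
  "v_s p x t = sqrt (s12 p t * tr_b x t)"

definition w_rudder :: "vessel \<Rightarrow> trajectory \<Rightarrow> real \<Rightarrow> real" where
  "w_rudder p x t =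
     (1 - f_w p)\<^sup>2 * s12 p t * tr_b x t + T_p p x t / (rho p / 2 * (pi / 4) * (D_p p)\<^sup>2)"

definition M_mat :: "vessel \<Rightarrow> real^3^3" where
  "M_mat p = vector
     [vector [mass p * (1 + k1_add p), 0, 0],
      vector [0, mass p * (1 + k1_add p), 0],
      vector [0, 0, I_0 p + k2_add p * I_w p]]"

definition R_mat :: "vessel \<Rightarrow> real \<Rightarrow> real^5^3" where
  "R_mat p t = (let \<theta> = s_path p t $ 3 in vector
     [vector [cos \<theta>, - cos \<theta>, - sin \<theta>, - sin \<theta>,   sin \<theta>],
      vector [sin \<theta>, - sin \<theta>,   cos \<theta>,   cos \<theta>, - cos \<theta>],
      vector [0, 0, L_H p, - L_P p, L_R p]])"

definition forces :: "vessel \<Rightarrow> trajectory \<Rightarrow> real \<Rightarrow> real^5" where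
  "forces p x t =
     vector [T_p p x t, tr_FD x t + tr_DR x t, tr_FH x t, F_P p x t, tr_FR x t]"

text \<open>
  Standing assumptions on the data.  \<open>k_c\<close> ranges over the positive integers: on a stretch where
  no converter is on, \<open>F_c\<close> would enter neither the cost nor the energy balance.
\<close>

definition vessel_data :: "vessel \<Rightarrow> bool" where
  "vessel_data p \<longleftrightarrow>
     smooth_path p \<and>
     a_T2 p \<ge> 0 \<and> a_T1 p \<ge> 0 \<and> a_T0 p > 0 \<and>
     a_Q2 p \<ge> 0 \<and> a_Q1 p \<ge> 0 \<and> a_Q0 p > 0 \<and>
     rho p > 0 \<and> D_p p > 0 \<and> k_p p \<ge> 1 \<and>
     S_lift p > 0 \<and> A_s p > 0 \<and> Omega p > 0 \<and> A_R p > 0 \<and> Lambda p > 0 \<and> k_tm p > 0 \<and>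
     C_Lmax p > 0 \<and> C_K p (omega_max p) > 0 \<and>
     R_i p \<ge> 0 \<and> U_0 p > 0 \<and> eta_DCDC p > 0 \<and> eta_EM p > 0 \<and> eta_g p > 0 \<and> i_g p > 0 \<and>
     P_aux p \<ge> 0 \<and>
     (\<forall>t\<in>{0..1}. k_c p t \<ge> 1) \<and> pw_continuous (\<lambda>t. real (k_c p t)) \<and>
     a_c0 p > 0 \<and> a_c1 p > 0 \<and> omega_T p > 0 \<and> v_r p > 0"

definition cost :: "vessel \<Rightarrow> trajectory \<Rightarrow> real" where
  "cost p x = integral {0..1}
     (\<lambda>t. (real (k_c p t) * a_c0 p + omega_T p) * tr_y x t + real (k_c p t) * a_c1 p * tr_Fc x t)"

definition regular_inputs :: "trajectory \<Rightarrow> bool" where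
  "regular_inputs x \<longleftrightarrow>
     pw_continuous (tr_FD x) \<and> pw_continuous (tr_FH x) \<and> pw_continuous (tr_FR x) \<and>
     pw_continuous (tr_y x) \<and> pw_continuous (tr_DR x) \<and> pw_continuous (tr_z x) \<and>
     pw_continuous (tr_n x) \<and> pw_continuous (tr_Fc x) \<and> pw_continuous (tr_Fb x)"

definition dynamics :: "vessel \<Rightarrow> trajectory \<Rightarrow> bool" where
  "dynamics p x \<longleftrightarrow>
     (\<exists>b' e'. has_pw_derivative (tr_b x) b' \<and> has_pw_derivative (tr_dE x) e' \<and>
       (\<forall>t\<in>{0..1}.
          R_mat p t *v forces p x t =
            M_mat p *v ((b' t / 2) *\<^sub>R dpath p t + tr_b x t *\<^sub>R ddpath p t) + tau p (s_path p t) \<and>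
          e' t = - tr_Fb x t * sqrt (s12 p t)))"

definition positivity :: "trajectory \<Rightarrow> real \<Rightarrow> bool" where
  "positivity x t \<longleftrightarrow> tr_b x t > 0 \<and> tr_y x t > 0 \<and> tr_z x t > 0"

text \<open>
  If \<open>w = 0\<close> then the lift bound forces \<open>F_R = 0\<close>, and the quotient in the rudder drag
  bound is read as \<open>0/0 = 0\<close>; \<open>w < 0\<close> is excluded by the lift bound.
\<close>

definition hydrodynamic_constraints :: "vessel \<Rightarrow> trajectory \<Rightarrow> real \<Rightarrow> bool" where
  "hydrodynamic_constraints p x t \<longleftrightarrow>
     \<bar>tr_FH x t\<bar> \<le> rho p / 2 * S_lift p * C_Lmax p * s12 p t * tr_b x t \<and>
     rho p / 2 * (C_F p (v_s p x t) + C_R p (v_s p x t)) * A_s p * s12 p t * tr_b x t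
       + 2 * (tr_FH x t)\<^sup>2 * A_s p / (rho p * pi * Omega p * (S_lift p)\<^sup>2 * s12 p t * tr_b x t)
       \<le> tr_FD x t \<and>
     \<bar>tr_FR x t\<bar> \<le> rho p / 2 * C_K p (omega_max p) * A_R p * (k_tm p)\<^sup>2 * w_rudder p x t \<and>
     tr_DR x t \<ge> 2.2 * (tr_FR x t)\<^sup>2 / (A_R p * pi * Lambda p * rho p * (k_tm p)\<^sup>2 * w_rudder p x t)"

definition relaxed_constraints :: "vessel \<Rightarrow> trajectory \<Rightarrow> real \<Rightarrow> bool" where
  "relaxed_constraints p x t \<longleftrightarrow>
     tr_z x t \<le> sqrt (s12 p t * tr_b x t * tr_n x t) \<and>
     1 / sqrt (tr_b x t) \<le> tr_y x t \<and>
     real (k_p p) * (F_dEp p x t / eta_EM_tilde p) + P_aux p * tr_y x t + F_battd p x t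
       \<le> real (k_c p t) * tr_Fc x t + tr_Fb x t * eta_DCDC p"

definition powertrain_limits :: "vessel \<Rightarrow> trajectory \<Rightarrow> real \<Rightarrow> bool" where
  "powertrain_limits p x t \<longleftrightarrow>
     tr_n x t \<le> (n_EMmax p / i_g p)\<^sup>2 \<and>
     Q_p p x t \<le> Q_EMmax p * eta_g p * i_g p \<and>
     F_EM p x t \<le> Phi p (P_EMmax p) x t \<and>
     0 \<le> tr_Fc x t \<and> tr_Fc x t \<le> Phi p (P_cmax p) x t \<and>
     dE_min p \<le> tr_dE x t \<and> tr_dE x t \<le> dE_max p \<and>
     - Phi p (P_chamax p) x t \<le> tr_Fb x t \<and> tr_Fb x t \<le> Phi p (P_dismax p) x t"

definition boundary_conditions :: "vessel \<Rightarrow> trajectory \<Rightarrow> bool" where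
  "boundary_conditions p x \<longleftrightarrow>
     tr_b x 0 = (v_init p)\<^sup>2 / s12 p 0 \<and>
     tr_b x 1 = (v_final p)\<^sup>2 / s12 p 1 \<and>
     tr_dE x 0 = tr_dE x 1"

definition feasible :: "vessel \<Rightarrow> trajectory \<Rightarrow> bool" where
  "feasible p x \<longleftrightarrow>
     regular_inputs x \<and> dynamics p x \<and> boundary_conditions p x \<and>
     (\<forall>t\<in>{0..1}. positivity x t \<and> hydrodynamic_constraints p x t \<and>
                 relaxed_constraints p x t \<and> powertrain_limits p x t)"

definition optimal :: "vessel \<Rightarrow> trajectory \<Rightarrow> bool" where
  "optimal p x \<longleftrightarrow> feasible p x \<and> (\<forall>x'. feasible p x' \<longrightarrow> cost p x \<le> cost p x')"

end

theory Submission
  imports Defs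
begin

text \<open>
  Strict slack in a constraint at one point persists on a nearby interval, since inputs are
  one-sidedly continuous, so the optimum can be varied there by a small bump.  A slack energy
  balance allows a smaller \<open>F_c\<close>.  A slack \<open>y_t\<close> can be decreased, as the battery
  dissipation bound keeps \<open>P_aux y_t + F_battd\<close> from growing to first order.  A slack \<open>z\<close> can be
  increased together with a change of the squared shaft speed that preserves the thrust;
  by the propeller condition this strictly lowers the propeller energy at equal cost, leaving
  an optimum whose energy balance is slack.
\<close>

section \<open>Piecewise continuous functions on the unit interval\<close>

lemma pw_continuous_if_continuous_on:
  assumes "continuous_on {0..1} f"
  shows "pw_continuous f"
proof -
  have at: "(f \<longlongrightarrow> f t) (at t within {0..1})" if "t \<in> {0..1}" for t
    using assms that by (auto simp: continuous_on_def)
  have right: "(f \<longlongrightarrow> f t) (at_right t)" if "t \<in> {0..<1}" for t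
  proof -
    have "at_right t = at t within {t..1}" 
      using that at_within_Icc_at_right[of t 1] by auto
    also have "\<dots> \<le> at t within {0..1}"
      using that by (intro at_le) auto
    finally show ?thesis
      using at[of t] that by (auto elim: tendsto_mono)
  qed
  have left: "(f \<longlongrightarrow> f t) (at_left t)" if "t \<in> {0<..1}" for t
  proof -
    have "at_left t = at t within {0..t}" 
      using that at_within_Icc_at_left[of 0 t] by auto
    also have "\<dots> \<le> at t within {0..1}"
      using that by (intro at_le) auto
    finally show ?thesis
      using at[of t] that by (auto elim: tendsto_mono)
  qed
  show ?thesis
    unfolding pw_continuous_def
    using assms left right by (auto intro!: exI[of _ "{}"]) (meson left greaterThanAtMost_iff)
qed

lemma pw_continuous_const: "pw_continuous (\<lambda>_. c)"
  by (intro pw_continuous_if_continuous_on continuous_intros)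

text \<open>The union of the two exceptional sets serves for the combination, and
  \<open>tend\<close> carries over the one-sided limits together with the normalised values. The
  operation is left abstract so that sums and products share one argument.\<close>

lemma pw_continuous_combine:
  assumes f: "pw_continuous f" and g: "pw_continuous g"
    and cont: "\<And>S. continuous_on S f \<Longrightarrow> continuous_on S g \<Longrightarrow> continuous_on S (\<lambda>t. op (f t) (g t))"
    and tend: "\<And>F l m. (f \<longlongrightarrow> l) F \<Longrightarrow> (g \<longlongrightarrow> m) F \<Longrightarrow> ((\<lambda>t. op (f t) (g t)) \<longlongrightarrow> op l m) F"
  shows "pw_continuous (\<lambda>t. op (f t) (g t))"
proof -
  obtain D1 where D1: "finite D1" "continuous_on ({0..1} - D1) f"
    using f by (auto simp: pw_continuous_def)
  obtain D2 where D2: "finite D2" "continuous_on ({0..1} - D2) g"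
    using g by (auto simp: pw_continuous_def)
  have "continuous_on ({0..1} - (D1 \<union> D2)) (\<lambda>t. op (f t) (g t))"
    by (intro cont continuous_on_subset[OF D1(2)] continuous_on_subset[OF D2(2)]) auto
  then have "\<exists>D. finite D \<and> continuous_on ({0..1} - D) (\<lambda>t. op (f t) (g t))"
    using D1(1) D2(1) by (intro exI[of _ "D1 \<union> D2"]) auto
  moreover have "\<exists>l. ((\<lambda>t. op (f t) (g t)) \<longlongrightarrow> l) (at_left t)" if "t \<in> {0<..1}" for t
    using f g that tend unfolding pw_continuous_def by metis
  ultimately show ?thesis
    using f g tend unfolding pw_continuous_def by auto
qed

lemma pw_continuous_add:
  "pw_continuous f \<Longrightarrow> pw_continuous g \<Longrightarrow> pw_continuous (\<lambda>t. f t + g t)"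
  by (erule pw_continuous_combine[where op = "(+)"]) (auto intro: continuous_intros tendsto_intros)

lemma pw_continuous_mult:
  "pw_continuous f \<Longrightarrow> pw_continuous g \<Longrightarrow> pw_continuous (\<lambda>t. f t * g t)"
  by (erule pw_continuous_combine[where op = "(*)"]) (auto intro: continuous_intros tendsto_intros)

text \<open>Compactness: the two one-sided limits at a point bound the function on a punctured
  neighbourhood, the value at the point is added to the bound, and finitely many such neighbourhoods
  cover the interval.\<close>

lemma pw_continuous_bounded:
  assumes "pw_continuous f"
  obtains B where "\<And>t. t \<in> {0..1} \<Longrightarrow> \<bar>f t\<bar> \<le> B"
proof -
  have bounded_along: "\<exists>B. eventually (\<lambda>t. \<bar>f t\<bar> \<le> B) F" if "(f \<longlongrightarrow> l) F" for F l
  proof -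
    have "eventually (\<lambda>t. dist (f t) l < 1) F"
      using that by (rule tendstoD) simp
    then have "eventually (\<lambda>t. \<bar>f t\<bar> \<le> \<bar>l\<bar> + 1) F"
      by (rule eventually_mono) (auto simp: dist_real_def)
    then show ?thesis ..
  qed
  have "\<exists>U B. open U \<and> t \<in> U \<and> (\<forall>u\<in>U \<inter> {0..1}. \<bar>f u\<bar> \<le> B)" if t: "t \<in> {0..1}" for t
  proof -
    \<comment> \<open>The guard \<open>u \<in> {0..1}\<close> makes this claim vacuous to the right
      of 1, and its mirror image below vacuous to the left of 0.\<close>
    have "\<exists>B. eventually (\<lambda>u. u \<in> {0..1} \<longrightarrow> \<bar>f u\<bar> \<le> B) (at_right t)"
    proof (cases "t < 1")
      case True
      then show ?thesis
        using assms t bounded_along[of "f t" "at_right t"] unfolding pw_continuous_def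
        by (auto elim: eventually_mono)
    next
      case False
      then show ?thesis using t by (auto simp: eventually_at_filter)
    qed
    then obtain B1 where B1: "eventually (\<lambda>u. u \<in> {0..1} \<longrightarrow> \<bar>f u\<bar> \<le> B1) (at_right t)" ..
    have "\<exists>B. eventually (\<lambda>u. u \<in> {0..1} \<longrightarrow> \<bar>f u\<bar> \<le> B) (at_left t)"
    proof (cases "t > 0")
      case True
      then obtain l where "(f \<longlongrightarrow> l) (at_left t)"
        using assms t unfolding pw_continuous_def by (meson greaterThanAtMost_iff atLeastAtMost_iff)
      from bounded_along[OF this] show ?thesis
        by (auto elim: eventually_mono)
    next
      case False
      then show ?thesis using t by (auto simp: eventually_at_filter)
    qed
    then obtain B2 where B2: "eventually (\<lambda>u. u \<in> {0..1} \<longrightarrow> \<bar>f u\<bar> \<le> B2) (at_left t)" ..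
    define B where "B = max \<bar>f t\<bar> (max B1 B2)"
    have "eventually (\<lambda>u. u \<in> {0..1} \<longrightarrow> \<bar>f u\<bar> \<le> B) (at t)"
      unfolding eventually_at_split using B1 B2 
      by (auto simp: B_def elim!: eventually_mono)
    then have "eventually (\<lambda>u. u \<in> {0..1} \<longrightarrow> \<bar>f u\<bar> \<le> B) (nhds t)"
      unfolding eventually_at_filter
      by (rule eventually_mono) (auto simp: B_def)
    then show ?thesis
      unfolding eventually_nhds by blast
  qed
  then obtain U B where UB: "\<And>t. t \<in> {0..1} \<Longrightarrow> open (U t) \<and> t \<in> U t \<and> (\<forall>u\<in>U t \<inter> {0..1}. \<bar>f u\<bar> \<le> B t)"
    by metis
  obtain C where C: "C \<subseteq> {0..1}" "finite C" "{0..1} \<subseteq> (\<Union>t\<in>C. U t)"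
    by (rule compactE_image[of "{0..1::real}" "{0..1}" U]) (use UB in auto)
  show thesis
  proof
    fix t :: real assume t: "t \<in> {0..1}"
    then obtain c where c: "c \<in> C" "t \<in> U c" using C by auto
    then have "\<bar>f t\<bar> \<le> B c" using UB C t by auto
    also have "\<dots> \<le> Max (B ` C)" using C c by auto
    finally show "\<bar>f t\<bar> \<le> Max (B ` C)" .
  qed
qed

text \<open>Off a finite, hence negligible, set the function is continuous and therefore measurable,
  and it is dominated by a constant.\<close>

lemma pw_continuous_integrable:
  assumes "pw_continuous f"
  shows "f integrable_on {0..1}"
proof -
  obtain D where D: "finite D" "continuous_on ({0..1} - D) f"
    using assms by (auto simp: pw_continuous_def)
  obtain B where B: "\<And>t. t \<in> {0..1} \<Longrightarrow> \<bar>f t\<bar> \<le> B"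
    using pw_continuous_bounded[OF assms] by blast
  have sets: "{0..1} - D \<in> sets lebesgue"
    using D(1) by (intro sets.Diff) (auto intro!: negligible_imp_sets)
  have neg: "negligible D" using D(1) by (rule negligible_finite)
  have "f integrable_on ({0..1} - D)"
  proof (rule measurable_bounded_by_integrable_imp_integrable[where g = "\<lambda>_. B"])
    show "f \<in> borel_measurable (lebesgue_on ({0..1} - D))"
      using D(2) sets by (rule continuous_imp_measurable_on_sets_lebesgue)
    show "(\<lambda>_. B) integrable_on {0..1} - D"
      by (rule integrable_spike_set[of _ "{0..1}"]) (auto intro: negligible_subset[OF neg])
  qed (use B sets in auto)
  then show ?thesis
    by (rule integrable_spike_set) (auto intro: negligible_subset[OF neg])
qed

section \<open>One-sided neighbourhoods and bump functions\<close>

text \<open>The side on which the normalisation in \<open>pw_continuous\<close> makes the value at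
  \<open>\<sigma>\<close> the limit. Strict inequalities at \<open>\<sigma>\<close> thus persist on
  an interval adjoining \<open>\<sigma>\<close> on this side.\<close>

definition at_inward :: "real \<Rightarrow> real filter" where
  "at_inward \<sigma> = (if \<sigma> < 1 then at_right \<sigma> else at_left \<sigma>)"

lemma pw_continuous_tendsto:
  "pw_continuous f \<Longrightarrow> \<sigma> \<in> {0..1} \<Longrightarrow> (f \<longlongrightarrow> f \<sigma>) (at_inward \<sigma>)"
  by (auto simp: pw_continuous_def at_inward_def)

lemma eventually_at_inward_interval:
  assumes "\<sigma> \<in> {0..1}" "eventually P (at_inward \<sigma>)"
  obtains c d where "0 \<le> c" "c < d" "d \<le> 1" "\<And>t. c < t \<Longrightarrow> t < d \<Longrightarrow> P t"
proof (cases "\<sigma> < 1")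
  case True
  then obtain e where e: "e > \<sigma>" "\<And>t. \<sigma> < t \<Longrightarrow> t < e \<Longrightarrow> P t"
    using assms(2) by (auto simp: at_inward_def eventually_at_right_field)
  show thesis
    by (rule that[of \<sigma> "min e 1"]) (use assms True e in auto)
next
  case False
  then obtain e where e: "e < \<sigma>" "\<And>t. e < t \<Longrightarrow> t < \<sigma> \<Longrightarrow> P t"
    using assms(2) by (auto simp: at_inward_def eventually_at_left_field)
  show thesis
    by (rule that[of "max e 0" \<sigma>]) (use assms False e in auto)
qed

text \<open>Pairs of a point near \<open>\<sigma>\<close> and a small positive step. The step is
  independent of the point, so that it may later be chosen as the height of a bump at that
  point.\<close>

abbreviation small_step :: "real \<Rightarrow> (real \<times> real) filter" where
  "small_step \<sigma> \<equiv> at_inward \<sigma> \<times>\<^sub>F at_right 0"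

text \<open>A property holding eventually for the product filter holds for all points of some
  interval and all steps below some bound; a bump supported in that interval and lower than that
  bound has the required values.\<close>

lemma bump_exists:
  assumes \<sigma>: "\<sigma> \<in> {0..1}" and ev: "\<forall>\<^sub>F (t, h) in small_step \<sigma>. P t h"
  obtains \<phi> \<tau> where "continuous_on UNIV \<phi>" "\<And>t. 0 \<le> \<phi> t"
    "\<tau> \<in> {0..1}" "0 < \<phi> \<tau>" "\<And>t. \<phi> t \<noteq> 0 \<Longrightarrow> P t (\<phi> t)"
proof -
  obtain A B where AB: "eventually A (at_inward \<sigma>)" "eventually B (at_right 0)"
    "\<And>t h. A t \<Longrightarrow> B h \<Longrightarrow> P t h"
    using ev by (auto simp: eventually_prod_filter)
  obtain c d where cd: "0 \<le> c" "c < d" "d \<le> 1" "\<And>t. c < t \<Longrightarrow> t < d \<Longrightarrow> A t"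
    using eventually_at_inward_interval[OF \<sigma> AB(1)] by metis
  obtain e where e: "e > 0" "\<And>h. 0 < h \<Longrightarrow> h < e \<Longrightarrow> B h"
    using AB(2) by (auto simp: eventually_at_right_field)
  \<comment> \<open>A parabola vanishing at both ends of the interval and cut off outside. Inside,
    \<open>(t - c) * (d - t)\<close> is at most 1, so the factor \<open>e / 2\<close> keeps the
    height below \<open>e\<close>.\<close>
  define \<phi> where "\<phi> t = max 0 (e / 2 * ((t - c) * (d - t)))" for t
  show thesis
  proof
    show "continuous_on UNIV \<phi>"
      unfolding \<phi>_def by (intro continuous_intros)
    show "0 < \<phi> ((c + d) / 2)"
    proof -
      have "0 < e / 2 * (((c + d) / 2 - c) * (d - (c + d) / 2))"
        using cd e by (intro mult_pos_pos) auto
      then show ?thesis unfolding \<phi>_def by linarith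
    qed
    show "(c + d) / 2 \<in> {0..1}" using cd by auto
    show "P t (\<phi> t)" if "\<phi> t \<noteq> 0" for t
    proof -
      have pos: "e / 2 * ((t - c) * (d - t)) > 0"
        using that unfolding \<phi>_def by linarith
      then have "(t - c) * (d - t) > 0"
        using e by (simp add: zero_less_mult_iff)
      then have t: "c < t" "t < d"
        using cd by (auto simp: zero_less_mult_iff)
      have "(t - c) * (d - t) \<le> 1 * 1"
        using t cd by (intro mult_mono) auto
      then have "e / 2 * ((t - c) * (d - t)) \<le> e / 2 * 1"
        using e by (intro mult_left_mono) auto
      then have "\<phi> t < e"
        using e by (auto simp: \<phi>_def)
      then show ?thesis
        using pos t by (intro AB(3) cd(4) e(2)) (auto simp: \<phi>_def)
    qed
  qed (auto simp: \<phi>_def)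
qed

lemma tendsto_small_step_fst:
  "pw_continuous f \<Longrightarrow> \<sigma> \<in> {0..1} \<Longrightarrow> ((\<lambda>u. f (fst u)) \<longlongrightarrow> f \<sigma>) (small_step \<sigma>)"
  by (rule filterlim_compose[OF pw_continuous_tendsto filterlim_fst])

lemma tendsto_small_step_snd: "(snd \<longlongrightarrow> 0) (small_step \<sigma>)"
  by (rule filterlim_compose[OF tendsto_ident_at filterlim_snd])

lemma eventually_small_step:
  assumes "\<sigma> \<in> {0..1}"
  shows "\<forall>\<^sub>F u in small_step \<sigma>. fst u \<in> {0..1} \<and> 0 < snd u"
proof -
  have "eventually (\<lambda>t. t \<in> {0..1}) (at_inward \<sigma>)"
    using assms by (auto simp: at_inward_def eventually_at_right_field eventually_at_left_field
        intro: exI[of _ 1] exI[of _ 0])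
  moreover have "eventually (\<lambda>h::real. 0 < h) (at_right 0)"
    by (simp add: eventually_at_filter)
  ultimately show ?thesis
    by (auto simp: eventually_prod_filter)
qed

section \<open>Feasible variations and descent of the cost\<close>

text \<open>Only inputs absent from the battery dynamics are varied, and they enter the equation of
  motion through the thrust alone. Hence both states can stay fixed as long as the thrust
  does.\<close>

definition vary :: "trajectory \<Rightarrow> (real \<Rightarrow> real) \<Rightarrow> real \<Rightarrow> real \<Rightarrow> real \<Rightarrow> real \<Rightarrow> trajectory" where
  "vary x \<phi> dy dz dn dF = x\<lparr>
     tr_y := \<lambda>t. tr_y x t + dy * \<phi> t, tr_z := \<lambda>t. tr_z x t + dz * \<phi> t,
     tr_n := \<lambda>t. tr_n x t + dn * \<phi> t, tr_Fc := \<lambda>t. tr_Fc x t + dF * \<phi> t\<rparr>"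

lemma vary_simps [simp]:
  "tr_b (vary x \<phi> dy dz dn dF) = tr_b x"
  "tr_dE (vary x \<phi> dy dz dn dF) = tr_dE x"
  "tr_FD (vary x \<phi> dy dz dn dF) = tr_FD x"
  "tr_FH (vary x \<phi> dy dz dn dF) = tr_FH x"
  "tr_FR (vary x \<phi> dy dz dn dF) = tr_FR x"
  "tr_DR (vary x \<phi> dy dz dn dF) = tr_DR x"
  "tr_Fb (vary x \<phi> dy dz dn dF) = tr_Fb x"
  "tr_y (vary x \<phi> dy dz dn dF) t = tr_y x t + dy * \<phi> t"
  "tr_z (vary x \<phi> dy dz dn dF) t = tr_z x t + dz * \<phi> t"
  "tr_n (vary x \<phi> dy dz dn dF) t = tr_n x t + dn * \<phi> t"
  "tr_Fc (vary x \<phi> dy dz dn dF) t = tr_Fc x t + dF * \<phi> t"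
  "Phi p P (vary x \<phi> dy dz dn dF) t = Phi p P x t"
  by (simp_all add: vary_def Phi_def)

text \<open>The pointwise constraints that remain to be checked after a thrust-preserving variation;
  the hydrodynamic ones depend on the varied inputs only through the thrust.\<close>

definition admissible :: "vessel \<Rightarrow> trajectory \<Rightarrow> real \<Rightarrow> bool" where
  "admissible p x t \<longleftrightarrow> positivity x t \<and> relaxed_constraints p x t \<and> powertrain_limits p x t"

text \<open>Locality in \<open>t\<close> allows the constraints to be tested with constant steps and
  the result to be transferred to a bump.\<close>

lemma admissible_vary_cong:
  assumes "\<phi> t = \<psi> t"
  shows "admissible p (vary x \<phi> dy dz dn dF) t \<longleftrightarrow> admissible p (vary x \<psi> dy dz dn dF) t"
  using assms
  by (simp add: admissible_def positivity_def relaxed_constraints_def powertrain_limits_def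
      F_EM_def F_dEp_def F_battd_def Q_p_def)

lemma admissible_vary_zero:
  assumes "\<phi> t = 0"
  shows "admissible p (vary x \<phi> dy dz dn dF) t \<longleftrightarrow> admissible p x t"
  using assms
  by (simp add: admissible_def positivity_def relaxed_constraints_def powertrain_limits_def
      F_EM_def F_dEp_def F_battd_def Q_p_def)

text \<open>Cancellation of the two increments of \<open>T_p\<close>; since \<open>T_p\<close> is
  affine in \<open>z\<close> and \<open>n\<close>, it keeps the thrust exactly, for steps of any
  size.\<close>

definition thrust_neutral :: "vessel \<Rightarrow> real \<Rightarrow> real \<Rightarrow> bool" where
  "thrust_neutral p dz dn \<longleftrightarrow>
     a_T1 p * rho p * D_p p ^ 3 * (1 - f_w p) * dz = a_T0 p * rho p * D_p p ^ 4 * dn"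

lemma T_p_vary:
  assumes "thrust_neutral p dz dn"
  shows "T_p p (vary x \<phi> dy dz dn dF) t = T_p p x t"
proof -
  have "a_T1 p * rho p * D_p p ^ 3 * (1 - f_w p) * (dz * \<phi> t) = a_T0 p * rho p * D_p p ^ 4 * (dn * \<phi> t)"
    using arg_cong[OF assms[unfolded thrust_neutral_def], of "\<lambda>v. v * \<phi> t"] by (simp only: mult.assoc)
  then show ?thesis
    unfolding T_p_def vary_simps distrib_left by linarith
qed

text \<open>Equal thrust gives equal forces and equal rudder inflow, so the dynamics and the
  hydrodynamic constraints carry over. Where the bump vanishes nothing changes at all.\<close>

lemma feasible_vary:
  assumes x: "feasible p x" and thrust: "thrust_neutral p dz dn"
    and cont: "continuous_on UNIV \<phi>"
    and adm: "\<And>t. t \<in> {0..1} \<Longrightarrow> \<phi> t \<noteq> 0 \<Longrightarrow> admissible p (vary x \<phi> dy dz dn dF) t"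
  shows "feasible p (vary x \<phi> dy dz dn dF)"
proof -
  let ?x = "vary x \<phi> dy dz dn dF"
  have \<phi>: "pw_continuous (\<lambda>t. c * \<phi> t)" for c
    by (intro pw_continuous_if_continuous_on continuous_intros continuous_on_subset[OF cont]) auto
  have "regular_inputs ?x"
    using x by (auto simp: feasible_def regular_inputs_def vary_def intro!: pw_continuous_add \<phi>)
  moreover have "forces p ?x t = forces p x t" for t
    by (simp add: forces_def T_p_vary[OF thrust] F_P_def)
  then have "dynamics p ?x"
    using x by (simp add: feasible_def dynamics_def)
  moreover have "boundary_conditions p ?x"
    using x by (simp add: feasible_def boundary_conditions_def)
  moreover have "hydrodynamic_constraints p ?x t \<longleftrightarrow> hydrodynamic_constraints p x t" for t
    by (simp add: hydrodynamic_constraints_def w_rudder_def v_s_def T_p_vary[OF thrust])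
  moreover have "admissible p ?x t" if "t \<in> {0..1}" for t
  proof (cases "\<phi> t = 0")
    case True
    then show ?thesis
      using x that by (simp add: admissible_vary_zero) (simp add: admissible_def feasible_def)
  qed (rule adm[OF that])
  ultimately show ?thesis
    using x by (simp add: feasible_def admissible_def)
qed

lemma feasible_bump:
  assumes "feasible p x" "thrust_neutral p dz dn" "\<sigma> \<in> {0..1}"
    and ev: "\<forall>\<^sub>F u in small_step \<sigma>. admissible p (vary x (\<lambda>_. snd u) dy dz dn dF) (fst u)"
  obtains \<phi> \<tau> where "continuous_on UNIV \<phi>" "\<And>t. 0 \<le> \<phi> t" "\<tau> \<in> {0..1}" "0 < \<phi> \<tau>"
    "feasible p (vary x \<phi> dy dz dn dF)"
proof -
  have "\<forall>\<^sub>F (t, h) in small_step \<sigma>. admissible p (vary x (\<lambda>_. h) dy dz dn dF) t"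
    using ev by (simp add: case_prod_beta')
  then obtain \<phi> \<tau> where \<phi>: "continuous_on UNIV \<phi>" "\<And>t. 0 \<le> \<phi> t"
    "\<tau> \<in> {0..1}" "0 < \<phi> \<tau>" "\<And>t. \<phi> t \<noteq> 0 \<Longrightarrow> admissible p (vary x (\<lambda>_. \<phi> t) dy dz dn dF) t"
    by (rule bump_exists[OF assms(3)]) blast
  have "admissible p (vary x \<phi> dy dz dn dF) t" if "\<phi> t \<noteq> 0" for t
    using \<phi>(5)[OF that] admissible_vary_cong[of \<phi> t "\<lambda>_. \<phi> t"] by simp
  then have "feasible p (vary x \<phi> dy dz dn dF)"
    by (intro feasible_vary[OF assms(1,2) \<phi>(1)])
  with \<phi>(1-4) show thesis by (rule that)
qed

text \<open>The cost is linear in \<open>y\<close> and \<open>F_c\<close>, so along the bump it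
  falls by at least \<open>e\<close> times the integral of \<open>\<phi>\<close>. That integral is
  positive because \<open>\<phi>\<close> is continuous, nonnegative and not identically zero on the
  interval.\<close>

lemma no_descent_direction:
  assumes data: "vessel_data p" and opt: "optimal p x" and thrust: "thrust_neutral p dz dn"
    and \<sigma>: "\<sigma> \<in> {0..1}"
    and ev: "\<forall>\<^sub>F u in small_step \<sigma>. admissible p (vary x (\<lambda>_. snd u) dy dz dn dF) (fst u)"
    and e: "0 < e"
    and descent: "\<And>t. t \<in> {0..1} \<Longrightarrow>
      (real (k_c p t) * a_c0 p + omega_T p) * dy + real (k_c p t) * a_c1 p * dF \<le> - e"
  shows False
proof -
  have x: "feasible p x" using opt by (simp add: optimal_def)
  then have reg: "pw_continuous (tr_y x)" "pw_continuous (tr_Fc x)"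
    by (auto simp: feasible_def regular_inputs_def)
  have kc: "pw_continuous (\<lambda>t. real (k_c p t))"
    using data by (simp add: vessel_data_def)
  obtain \<phi> \<tau> where \<phi>: "continuous_on UNIV \<phi>" "\<And>t. 0 \<le> \<phi> t" "\<tau> \<in> {0..1}" "0 < \<phi> \<tau>"
    and x': "feasible p (vary x \<phi> dy dz dn dF)"
    by (rule feasible_bump[OF x thrust \<sigma> ev]) blast
  have \<phi>c: "continuous_on {0..1} \<phi>" by (rule continuous_on_subset[OF \<phi>(1)]) simp
  have \<phi>pw: "pw_continuous (\<lambda>t. c * \<phi> t)" for c
    by (intro pw_continuous_if_continuous_on continuous_intros \<phi>c)
  define g where "g y F t = (real (k_c p t) * a_c0 p + omega_T p) * y t + real (k_c p t) * a_c1 p * F t"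
    for y F t
  have int: "g y F integrable_on {0..1}" if "pw_continuous y" "pw_continuous F" for y F
    unfolding g_def
    by (intro pw_continuous_integrable pw_continuous_add pw_continuous_mult kc that pw_continuous_const)
  let ?y = "\<lambda>t. tr_y x t + dy * \<phi> t" and ?F = "\<lambda>t. tr_Fc x t + dF * \<phi> t"
  have "g ?y ?F t \<le> g (tr_y x) (tr_Fc x) t - e * \<phi> t" if "t \<in> {0..1}" for t
    using mult_right_mono[OF descent[OF that] \<phi>(2)[of t]] by (simp add: g_def algebra_simps)
  moreover have int\<phi>: "(\<lambda>t. e * \<phi> t) integrable_on {0..1}"
    by (rule pw_continuous_integrable[OF \<phi>pw])
  ultimately have "integral {0..1} (g ?y ?F) \<le> integral {0..1} (\<lambda>t. g (tr_y x) (tr_Fc x) t - e * \<phi> t)"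
    by (intro integral_le integrable_diff int int\<phi> reg pw_continuous_add \<phi>pw) auto
  also have "\<dots> = integral {0..1} (g (tr_y x) (tr_Fc x)) - integral {0..1} (\<lambda>t. e * \<phi> t)"
    by (intro integral_diff int int\<phi> reg)
  finally have "cost p (vary x \<phi> dy dz dn dF) \<le> cost p x - e * integral {0..1} \<phi>"
    by (simp add: cost_def g_def[abs_def])
  moreover have "cost p x \<le> cost p (vary x \<phi> dy dz dn dF)"
    using opt x' by (simp add: optimal_def)
  ultimately have "e * integral {0..1} \<phi> \<le> 0" by simp
  then have "integral {0..1} \<phi> \<le> 0" using e by (simp add: mult_le_0_iff)
  moreover have "integral {0..1} \<phi> \<ge> 0"
    by (intro integral_nonneg integrable_continuous_real \<phi>c) (use \<phi> in auto)
  ultimately have "integral {0..1} \<phi> = 0" by simp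
  then have "\<forall>t\<in>{0..1}. \<phi> t = 0"
    using integral_eq_0_iff[OF \<phi>c] \<phi>(2) by auto
  then show False using \<phi>(3,4) by auto
qed

section \<open>Continuity and positivity along a feasible trajectory\<close>

lemma feasible_pw_continuous:
  assumes "vessel_data p" "feasible p x"
  shows "pw_continuous (tr_y x)" "pw_continuous (tr_z x)" "pw_continuous (tr_n x)"
    "pw_continuous (tr_Fc x)" "pw_continuous (tr_Fb x)" "pw_continuous (tr_b x)"
    "pw_continuous (s12 p)" "pw_continuous (\<lambda>t. real (k_c p t))"
proof -
  show "pw_continuous (tr_y x)" "pw_continuous (tr_z x)" "pw_continuous (tr_n x)"
    "pw_continuous (tr_Fc x)" "pw_continuous (tr_Fb x)"
    using assms by (auto simp: feasible_def regular_inputs_def)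
  show "pw_continuous (\<lambda>t. real (k_c p t))"
    using assms by (simp add: vessel_data_def)
  show "pw_continuous (tr_b x)"
    using assms by (auto simp: feasible_def dynamics_def has_pw_derivative_def
        intro!: pw_continuous_if_continuous_on)
  have "continuous_on {0..1} (dpath p)"
    using assms unfolding vessel_data_def smooth_path_def continuous_on_eq_continuous_within
    by (auto intro: differentiable_imp_continuous_within)
  then have "continuous_on {0..1} (\<lambda>t. (dpath p t $ 1)\<^sup>2 + (dpath p t $ 2)\<^sup>2)"
    by (intro continuous_on_add continuous_on_power continuous_on_component)
  then show "pw_continuous (s12 p)"
    by (intro pw_continuous_if_continuous_on) (simp add: s12_def[abs_def])
qed

text \<open>A positive \<open>z\<close> below the square root forces a positive radicand. This is
  the source of the positivity of the squared shaft speed, which \<open>positivity\<close> does not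
  list.\<close>

lemma speed_product_positive:
  assumes "positivity x t" "relaxed_constraints p x t"
  shows "0 < s12 p t" "0 < tr_n x t"
proof -
  have "0 < sqrt (s12 p t * tr_b x t * tr_n x t)"
    using assms unfolding positivity_def relaxed_constraints_def by linarith
  then have "0 < s12 p t * tr_b x t * tr_n x t" by simp
  moreover have "0 \<le> s12 p t" by (simp add: s12_def)
  moreover have "0 < tr_b x t" using assms by (simp add: positivity_def)
  ultimately show "0 < s12 p t" "0 < tr_n x t"
    by (auto simp: zero_less_mult_iff mult_less_0_iff)
qed

lemma tendsto_eventually_less:
  assumes "(f \<longlongrightarrow> (a::real)) F" "(g \<longlongrightarrow> b) F" "a < b"
  shows "\<forall>\<^sub>F u in F. f u < g u"
proof -
  have "\<forall>\<^sub>F u in F. 0 < g u - f u"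
    by (rule order_tendstoD(1)[OF tendsto_diff[OF assms(2,1)]]) (use assms in simp)
  then show ?thesis by simp
qed

section \<open>Tightness of the three relaxed constraints\<close>

text \<open>Lowering \<open>F_c\<close> alone can only violate the energy balance and the bound
  \<open>0 \<le> F_c\<close>. Slack in the former and \<open>converter\<close> for the latter leave
  room, while the cost falls at a rate of at least \<open>a_c1\<close>, as at least one converter is
  on.\<close>

lemma energy_balance_tight:
  assumes data: "vessel_data p" and opt: "optimal p x"
    and converter: "\<forall>t\<in>{0..1}. 0 < tr_Fc x t" and \<sigma>: "\<sigma> \<in> {0..1}"
  shows "real (k_c p \<sigma>) * tr_Fc x \<sigma> + tr_Fb x \<sigma> * eta_DCDC p =
    real (k_p p) * (F_dEp p x \<sigma> / eta_EM_tilde p) + P_aux p * tr_y x \<sigma> + F_battd p x \<sigma>"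
proof (rule ccontr)
  assume neq: "\<not> ?thesis"
  have x: "feasible p x" using opt by (simp add: optimal_def)
  then have adm: "admissible p x t" if "t \<in> {0..1}" for t
    using that by (simp add: feasible_def admissible_def)
  note pw = feasible_pw_continuous[OF data x, THEN tendsto_small_step_fst, OF \<sigma>]
  have pos: "tr_y x \<sigma> \<noteq> 0" "tr_z x \<sigma> \<noteq> 0"
    using adm[OF \<sigma>] by (auto simp: admissible_def positivity_def)
  have etane: "eta_EM_tilde p \<noteq> 0"
    using data by (simp add: vessel_data_def eta_EM_tilde_def)
  define L where "L t = real (k_p p) * (F_dEp p x t / eta_EM_tilde p) + P_aux p * tr_y x t + F_battd p x t" for t
  \<comment> \<open>The \<open>- 0\<close> is the limit of the step \<open>- snd u\<close>, so that
    the inequality has the form of the limits of both sides. Later terms such as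
    \<open>\<eta> * 0\<close> and \<open>dn * 0\<close> have the same origin.\<close>
  have "L \<sigma> < real (k_c p \<sigma>) * (tr_Fc x \<sigma> - 0) + tr_Fb x \<sigma> * eta_DCDC p"
    using adm[OF \<sigma>] neq by (auto simp: L_def admissible_def relaxed_constraints_def)
  moreover have "((\<lambda>u. L (fst u)) \<longlongrightarrow> L \<sigma>) (small_step \<sigma>)"
    unfolding L_def F_dEp_def F_battd_def
    by (intro tendsto_intros pw pos etane)
  ultimately have ev1: "\<forall>\<^sub>F u in small_step \<sigma>. L (fst u) <
      real (k_c p (fst u)) * (tr_Fc x (fst u) - snd u) + tr_Fb x (fst u) * eta_DCDC p"
    by (rule tendsto_eventually_less[rotated 2]) (intro tendsto_intros pw tendsto_small_step_snd)
  have ev2: "\<forall>\<^sub>F u in small_step \<sigma>. snd u < tr_Fc x (fst u)"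
    using converter \<sigma>
    by (intro tendsto_eventually_less[OF tendsto_small_step_snd pw(4)]) auto
  have "\<forall>\<^sub>F u in small_step \<sigma>. admissible p (vary x (\<lambda>_. snd u) 0 0 0 (-1)) (fst u)"
    using ev1 ev2 eventually_small_step[OF \<sigma>]
  proof eventually_elim
    case (elim u)
    then show ?case
      using adm[of "fst u"]
      by (auto simp: admissible_def positivity_def relaxed_constraints_def powertrain_limits_def
          L_def F_EM_def F_dEp_def F_battd_def Q_p_def)
  qed
  moreover have "thrust_neutral p 0 0" by (simp add: thrust_neutral_def)
  moreover have "(real (k_c p t) * a_c0 p + omega_T p) * 0 + real (k_c p t) * a_c1 p * (-1) \<le> - a_c1 p"
    if "t \<in> {0..1}" for t
    using data that by (auto simp: vessel_data_def)
  moreover have "0 < a_c1 p" using data by (simp add: vessel_data_def)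
  ultimately show False
    using no_descent_direction[OF data opt _ \<sigma>] by blast
qed

text \<open>Where the battery loss equals the auxiliary load, decreasing \<open>y\<close> by \<open>h\<close> raises the energy
  demand only to second order in \<open>h\<close>; a first-order increase of \<open>F_c\<close> covers it while the cost
  still falls.\<close>

lemma inverse_speed_tight:
  assumes data: "vessel_data p" and opt: "optimal p x"
    and dissipation: "\<forall>t\<in>{0..1}. P_battd p (tr_Fb x t / tr_y x t) \<le> P_aux p"
    and borderline: "\<forall>t\<in>{0..1}. 0 < P_aux p \<and> P_battd p (tr_Fb x t / tr_y x t) = P_aux p
                     \<longrightarrow> tr_Fc x t < Phi p (P_cmax p) x t"
    and \<sigma>: "\<sigma> \<in> {0..1}"
  shows "tr_y x \<sigma> = 1 / sqrt (tr_b x \<sigma>)"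
proof (rule ccontr)
  assume neq: "\<not> ?thesis"
  have x: "feasible p x" using opt by (simp add: optimal_def)
  then have adm: "admissible p x t" if "t \<in> {0..1}" for t
    using that by (simp add: feasible_def admissible_def)
  note pw = feasible_pw_continuous[OF data x, THEN tendsto_small_step_fst, OF \<sigma>]
  note snd0 = tendsto_small_step_snd[of \<sigma>]
  have thrust: "thrust_neutral p 0 0" by (simp add: thrust_neutral_def)
  have pars: "0 < a_c0 p" "0 < a_c1 p" "0 < omega_T p" "0 \<le> P_aux p" "v_r p \<noteq> 0"
    using data by (auto simp: vessel_data_def)
  have kc1: "1 \<le> real (k_c p t)" if "t \<in> {0..1}" for t
    using data that by (auto simp: vessel_data_def)
  have y_pos: "0 < tr_y x t" if "t \<in> {0..1}" for t
    using adm[OF that] by (simp add: admissible_def positivity_def)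
  have b_pos: "0 < tr_b x t" if "t \<in> {0..1}" for t
    using adm[OF that] by (simp add: admissible_def positivity_def)
  define r where "r = R_i p / (U_0 p)\<^sup>2"
  have loss: "r * (tr_Fb x t)\<^sup>2 \<le> P_aux p * (tr_y x t)\<^sup>2" if "t \<in> {0..1}" for t
  proof -
    have "r * (tr_Fb x t)\<^sup>2 / (tr_y x t)\<^sup>2 \<le> P_aux p"
      using dissipation that by (simp add: P_battd_def r_def power_divide)
    then show ?thesis
      using y_pos[OF that] by (simp add: pos_divide_le_eq)
  qed
  have "1 / sqrt (tr_b x \<sigma>) < tr_y x \<sigma> - 0"
    using adm[OF \<sigma>] neq by (simp add: admissible_def relaxed_constraints_def)
  then have ev1: "\<forall>\<^sub>F u in small_step \<sigma>. 1 / sqrt (tr_b x (fst u)) < tr_y x (fst u) - snd u"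
    using b_pos[OF \<sigma>]
    by (intro tendsto_eventually_less[OF _ tendsto_diff[OF pw(1) snd0]])
      (auto intro!: tendsto_intros pw)
  \<comment> \<open>\<open>1 / (y - h) - 1 / y = h / (y (y - h))\<close>\<close>
  have balance: "P_aux p * (y - h) + r * (F\<^sup>2 / (y - h)) \<le> P_aux p * y + r * (F\<^sup>2 / y) + K"
    if "0 < h" "h < y" "r * F\<^sup>2 * h \<le> (P_aux p * h + K) * (y * (y - h))" for y h F K :: real
  proof -
    have "r * (F\<^sup>2 / (y - h)) = r * (F\<^sup>2 / y) + r * F\<^sup>2 * h / (y * (y - h))"
      using that by (simp add: field_simps)
    moreover have "r * F\<^sup>2 * h / (y * (y - h)) \<le> P_aux p * h + K"
      using that by (simp add: pos_divide_le_eq)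
    ultimately show ?thesis by (simp add: algebra_simps)
  qed
  show False
  \<comment> \<open>Away from the borderline case, lowering \<open>y\<close> alone suffices; in the
    borderline case \<open>F_c\<close> is raised along with it.\<close>
  proof (cases "0 < P_aux p \<and> P_battd p (tr_Fb x \<sigma> / tr_y x \<sigma>) = P_aux p")
    case False
    \<comment> \<open>For a positive step smaller than \<open>y\<close> this is exactly the
      condition that the energy demand does not grow, that is, \<open>balance\<close> with
      \<open>K = 0\<close>. If the auxiliary load is zero, \<open>loss\<close> gives it directly;
      otherwise the dissipation bound is strict at \<open>\<sigma>\<close>.\<close>
    have "\<forall>\<^sub>F u in small_step \<sigma>.
      r * (tr_Fb x (fst u))\<^sup>2 \<le> P_aux p * (tr_y x (fst u) * (tr_y x (fst u) - snd u))"
    proof (cases "P_aux p = 0")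
      case True
      show ?thesis
        using eventually_small_step[OF \<sigma>]
        by eventually_elim (use loss True in auto)
    next
      case nz: False
      then have "P_battd p (tr_Fb x \<sigma> / tr_y x \<sigma>) < P_aux p"
        using False pars dissipation \<sigma> by force
      then have "r * (tr_Fb x \<sigma>)\<^sup>2 / (tr_y x \<sigma>)\<^sup>2 < P_aux p"
        by (simp add: P_battd_def r_def power_divide)
      then have "r * (tr_Fb x \<sigma>)\<^sup>2 < P_aux p * (tr_y x \<sigma> * (tr_y x \<sigma> - 0))"
        using y_pos[OF \<sigma>] by (simp add: pos_divide_less_eq power2_eq_square[of "tr_y x \<sigma>"])
      then have "\<forall>\<^sub>F u in small_step \<sigma>.
        r * (tr_Fb x (fst u))\<^sup>2 < P_aux p * (tr_y x (fst u) * (tr_y x (fst u) - snd u))"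
        by (rule tendsto_eventually_less[rotated 2]) (intro tendsto_intros pw snd0)+
      then show ?thesis by (rule eventually_mono) simp
    qed
    then have "\<forall>\<^sub>F u in small_step \<sigma>. admissible p (vary x (\<lambda>_. snd u) (-1) 0 0 0) (fst u)"
      using ev1 eventually_small_step[OF \<sigma>]
    proof eventually_elim
      case (elim u)
      let ?y = "tr_y x (fst u)" and ?F = "tr_Fb x (fst u)"
      have "0 < 1 / sqrt (tr_b x (fst u))" using b_pos elim by simp
      then have y: "snd u < ?y" using elim by linarith
      have "r * ?F\<^sup>2 * snd u \<le> (P_aux p * snd u + 0) * (?y * (?y - snd u))"
        using mult_right_mono[OF elim(1), of "snd u"] elim by (simp add: mult_ac)
      with balance[of "snd u" ?y ?F 0] y elim
      have "P_aux p * (?y - snd u) + r * (?F\<^sup>2 / (?y - snd u)) \<le> P_aux p * ?y + r * (?F\<^sup>2 / ?y)"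
        by simp
      then show ?case
        using adm[of "fst u"] elim y
        by (auto simp: admissible_def positivity_def relaxed_constraints_def powertrain_limits_def
            F_EM_def F_dEp_def F_battd_def Q_p_def r_def)
    qed
    then show False
      by (rule no_descent_direction[OF data opt thrust \<sigma>, where e = "omega_T p"])
        (use pars in auto)
  next
    case True
    \<comment> \<open>At this rate the added converter cost \<open>k_c * a_c1 * \<eta>\<close>
      cancels the saved idle cost \<open>k_c * a_c0\<close>, so the weight on time is a net
      gain.\<close>
    define \<eta> where "\<eta> = a_c0 p / a_c1 p"
    have \<eta>: "0 < \<eta>" "a_c1 p * \<eta> = a_c0 p" using pars by (auto simp: \<eta>_def)
    have "tr_Fc x \<sigma> + \<eta> * 0 < Phi p (P_cmax p) x \<sigma>"
      using borderline True \<sigma> by auto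
    moreover have "((\<lambda>u. Phi p (P_cmax p) x (fst u)) \<longlongrightarrow> Phi p (P_cmax p) x \<sigma>) (small_step \<sigma>)"
      unfolding Phi_def by (intro tendsto_intros pw) (use pars in auto)
    ultimately have ev2: "\<forall>\<^sub>F u in small_step \<sigma>.
        tr_Fc x (fst u) + \<eta> * snd u < Phi p (P_cmax p) x (fst u)"
      by (rule tendsto_eventually_less[rotated 2, OF _ tendsto_add[OF pw(4) tendsto_mult[OF tendsto_const snd0]]])
    \<comment> \<open>By \<open>loss\<close>, a step \<open>h\<close> raises the demand by at most
      \<open>P_aux * h^2 / (y - h)\<close>. The inequality \<open>ev3\<close> bounds this by
      \<open>\<eta> * h\<close>, the increase of \<open>F_c\<close>.\<close>
    have "P_aux p * 0 < \<eta> * (tr_y x \<sigma> - 0)"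
      using \<eta> y_pos[OF \<sigma>] by simp
    then have ev3: "\<forall>\<^sub>F u in small_step \<sigma>. P_aux p * snd u < \<eta> * (tr_y x (fst u) - snd u)"
      by (rule tendsto_eventually_less[rotated 2]) (intro tendsto_intros pw snd0)+
    have "\<forall>\<^sub>F u in small_step \<sigma>. admissible p (vary x (\<lambda>_. snd u) (-1) 0 0 \<eta>) (fst u)"
      using ev1 ev2 ev3 eventually_small_step[OF \<sigma>]
    proof eventually_elim
      case (elim u)
      let ?y = "tr_y x (fst u)" and ?F = "tr_Fb x (fst u)" and ?h = "snd u"
      have t: "fst u \<in> {0..1}" using elim by simp
      have "0 < 1 / sqrt (tr_b x (fst u))" using b_pos elim by simp
      then have y: "?h < ?y" using elim by linarith
      have "r * ?F\<^sup>2 * ?h \<le> P_aux p * ?y\<^sup>2 * ?h"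
        using loss[OF t] elim by (intro mult_right_mono) auto
      also have "\<dots> = P_aux p * ?h * (?y * (?y - ?h)) + ?h * ?y * (P_aux p * ?h)"
        by (simp add: algebra_simps power2_eq_square)
      also have "\<dots> \<le> P_aux p * ?h * (?y * (?y - ?h)) + ?h * ?y * (\<eta> * (?y - ?h))"
        using elim y by (intro add_left_mono mult_left_mono) auto
      also have "\<dots> = (P_aux p * ?h + \<eta> * ?h) * (?y * (?y - ?h))"
        by (simp add: algebra_simps)
      finally have "P_aux p * (?y - ?h) + r * (?F\<^sup>2 / (?y - ?h)) 
          \<le> P_aux p * ?y + r * (?F\<^sup>2 / ?y) + \<eta> * ?h"
        using y elim by (intro balance) auto
      moreover have "1 * (\<eta> * ?h) \<le> real (k_c p (fst u)) * (\<eta> * ?h)"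
        using kc1[OF t] \<eta> elim by (intro mult_right_mono) auto
      moreover have "0 \<le> \<eta> * ?h" using \<eta> elim by simp
      ultimately show ?case
        using adm[of "fst u"] elim y
        by (auto simp: admissible_def positivity_def relaxed_constraints_def powertrain_limits_def
            F_EM_def F_dEp_def F_battd_def Q_p_def r_def distrib_left)
    qed
    moreover have
      "(real (k_c p t) * a_c0 p + omega_T p) * (-1) + real (k_c p t) * a_c1 p * \<eta> \<le> - omega_T p" for t
      by (simp add: mult.assoc \<eta>(2))
    ultimately show False
      using no_descent_direction[OF data opt thrust \<sigma> _ pars(3)] by blast
  qed
qed

text \<open>Along thrust-preserving changes \<open>(h, dn h)\<close> of \<open>(z, n)\<close>, the quotient satisfies
  \<open>(n + dn h)\<^sup>2 / (z + h) - n\<^sup>2 / z = h (dn\<^sup>2 - (n - dn z)\<^sup>2 / (z (z + h)))\<close>, and the propeller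
  condition makes the coefficient \<open>- k\<^sub>2 - k\<^sub>1 dn + k\<^sub>0 dn\<^sup>2\<close> of \<open>h\<close> negative unless \<open>f\<^sub>w = 1\<close>.\<close>

lemma propeller_energy_decreasing:
  assumes data: "vessel_data p"
    and propeller: "1 < a_Q1 p * a_T0 p / (a_Q0 p * a_T1 p)
                      - a_Q2 p * (a_T0 p)\<^sup>2 / (a_Q0 p * (a_T1 p)\<^sup>2)"
    and dn: "dn = a_T1 p * (1 - f_w p) / (a_T0 p * D_p p)"
    and pos: "0 < tr_z x t" "0 < tr_n x t" "0 < \<phi> t"
  shows "F_dEp p (vary x \<phi> dy 1 dn dF) t < F_dEp p x t"
proof -
  have d: "0 \<le> a_T1 p" "0 < a_T0 p" "0 \<le> a_Q1 p" "0 \<le> a_Q2 p" "0 < a_Q0 p" "0 < rho p" "0 < D_p p"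
    using data by (auto simp: vessel_data_def)
  \<comment> \<open>If \<open>a_T1\<close> were zero, both quotients would be divisions by zero with
    value 0, and the propeller condition would read \<open>1 < 0\<close>.\<close>
  have T1: "0 < a_T1 p" using propeller d by (cases "a_T1 p = 0") auto
  \<comment> \<open>Multiplied by \<open>a_Q0 * \<alpha>^2\<close>, the propeller condition becomes
    the quadratic inequality \<open>slope\<close>. Up to the factor \<open>K * c^2\<close> its left
    side is the coefficient of \<open>h\<close> in question, because
    \<open>D_p * dn = \<alpha> * c\<close>.\<close>
  define \<alpha> where "\<alpha> = a_T1 p / a_T0 p"
  define c where "c = 1 - f_w p"
  have \<alpha>: "0 < \<alpha>" using d T1 by (simp add: \<alpha>_def)
  have "1 < a_Q1 p / (a_Q0 p * \<alpha>) - a_Q2 p / (a_Q0 p * \<alpha>\<^sup>2)"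
    using propeller d T1 by (simp add: \<alpha>_def power_divide)
  then have "1 * (a_Q0 p * \<alpha>\<^sup>2) < (a_Q1 p / (a_Q0 p * \<alpha>) - a_Q2 p / (a_Q0 p * \<alpha>\<^sup>2)) * (a_Q0 p * \<alpha>\<^sup>2)"
    using \<alpha> d by (intro mult_strict_right_mono) auto
  also have "\<dots> = a_Q1 p * \<alpha> - a_Q2 p"
    using \<alpha> d by (simp add: field_simps power2_eq_square)
  finally have slope: "- a_Q2 p - a_Q1 p * \<alpha> + a_Q0 p * \<alpha>\<^sup>2 < 0"
    using d by linarith
  let ?z = "tr_z x t" and ?n = "tr_n x t" and ?h = "\<phi> t"
  define K where "K = 2 * pi * rho p * D_p p ^ 3"
  have K: "0 < K" using d by (simp add: K_def)
  have dn': "D_p p * dn = \<alpha> * c" using d by (simp add: dn \<alpha>_def c_def)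
  have quot: "(?n + dn * ?h)\<^sup>2 / (?z + ?h) = ?n\<^sup>2 / ?z + ?h * dn\<^sup>2 - ?h * ((?n - dn * ?z)\<^sup>2 / (?z * (?z + ?h)))"
    using pos by (simp add: divide_simps) (simp add: algebra_simps power2_eq_square)
  have "F_dEp p (vary x \<phi> dy 1 dn dF) t - F_dEp p x t
      = K * ?h * (- a_Q2 p * c\<^sup>2 - a_Q1 p * c * (D_p p * dn) + a_Q0 p * (D_p p * dn)\<^sup>2
          - a_Q0 p * (D_p p)\<^sup>2 * ((?n - dn * ?z)\<^sup>2 / (?z * (?z + ?h))))"
    unfolding F_dEp_def vary_simps times_divide_eq_right[symmetric] mult_1 quot K_def c_def
    by (simp add: algebra_simps power2_eq_square power3_eq_cube numeral_eq_Suc)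
  also have "\<dots> = K * ?h * (c\<^sup>2 * (- a_Q2 p - a_Q1 p * \<alpha> + a_Q0 p * \<alpha>\<^sup>2)
          - a_Q0 p * (D_p p)\<^sup>2 * ((?n - dn * ?z)\<^sup>2 / (?z * (?z + ?h))))"
    unfolding dn' by (simp add: algebra_simps power2_eq_square)
  also have "\<dots> < 0"
  proof (rule mult_pos_neg)
    have nonneg: "0 \<le> a_Q0 p * (D_p p)\<^sup>2 * ((?n - dn * ?z)\<^sup>2 / (?z * (?z + ?h)))"
      using d pos by simp
    show "c\<^sup>2 * (- a_Q2 p - a_Q1 p * \<alpha> + a_Q0 p * \<alpha>\<^sup>2)
        - a_Q0 p * (D_p p)\<^sup>2 * ((?n - dn * ?z)\<^sup>2 / (?z * (?z + ?h))) < 0"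
    proof (cases "c = 0")
      \<comment> \<open>For \<open>f_w = 1\<close> the linear coefficient vanishes and
        \<open>dn = 0\<close>; the strict decrease then comes from the remaining term
        \<open>n^2 / (z * (z + h))\<close>.\<close>
      case True
      then have "dn = 0" by (simp add: dn c_def)
      then show ?thesis using True d pos by simp
    next
      case False
      then have "c\<^sup>2 * (- a_Q2 p - a_Q1 p * \<alpha> + a_Q0 p * \<alpha>\<^sup>2) < 0"
        using slope by (intro mult_pos_neg) auto
      then show ?thesis using nonneg by linarith
    qed
  qed (use K pos in simp)
  finally show ?thesis by simp
qed

text \<open>The strict limits \<open>speed\<close> and \<open>torque\<close> survive a small change
  of \<open>n\<close>, and the machine power limit survives because the propeller energy falls. As
  \<open>z\<close> and \<open>n\<close> do not enter the cost, the contradiction comes from applying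
  \<open>energy_balance_tight\<close> to two optima.\<close>

lemma speed_product_tight:
  assumes data: "vessel_data p" and opt: "optimal p x"
    and propeller: "1 < a_Q1 p * a_T0 p / (a_Q0 p * a_T1 p)
                      - a_Q2 p * (a_T0 p)\<^sup>2 / (a_Q0 p * (a_T1 p)\<^sup>2)"
    and speed: "\<forall>t\<in>{0..1}. i_g p * sqrt (tr_n x t) < n_EMmax p"
    and torque: "\<forall>t\<in>{0..1}. Q_p p x t / (eta_g p * i_g p) < Q_EMmax p"
    and converter: "\<forall>t\<in>{0..1}. 0 < tr_Fc x t"
    and \<sigma>: "\<sigma> \<in> {0..1}"
  shows "tr_z x \<sigma> = sqrt (s12 p \<sigma> * tr_b x \<sigma> * tr_n x \<sigma>)"
proof (rule ccontr)
  assume neq: "\<not> ?thesis"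
  have x: "feasible p x" using opt by (simp add: optimal_def)
  then have adm: "admissible p x t" if "t \<in> {0..1}" for t
    using that by (simp add: feasible_def admissible_def)
  note pw = feasible_pw_continuous[OF data x, THEN tendsto_small_step_fst, OF \<sigma>]
  note snd0 = tendsto_small_step_snd[of \<sigma>]
  have d: "0 < a_T0 p" "0 < rho p" "0 < D_p p" "0 < i_g p" "0 < eta_g p" "0 < eta_EM p" "0 < real (k_p p)"
    using data by (auto simp: vessel_data_def)
  then have eta: "0 < eta_EM_tilde p" by (simp add: eta_EM_tilde_def)
  have z_pos: "0 < tr_z x t" if "t \<in> {0..1}" for t
    using adm[OF that] by (simp add: admissible_def positivity_def)
  have n_pos: "0 < tr_n x t" if "t \<in> {0..1}" for t
    using adm[OF that] speed_product_positive by (auto simp: admissible_def)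
  \<comment> \<open>The solution of \<open>thrust_neutral\<close> for \<open>dz = 1\<close>; its
    sign is that of \<open>1 - f_w\<close> or it is zero.\<close>
  define dn where "dn = a_T1 p * (1 - f_w p) / (a_T0 p * D_p p)"
  note F_less = propeller_energy_decreasing[OF data propeller dn_def]
  have thrust: "thrust_neutral p 1 dn"
    using d by (simp add: thrust_neutral_def dn_def field_simps numeral_eq_Suc)
  have "tr_z x \<sigma> + 0 < sqrt (s12 p \<sigma> * tr_b x \<sigma> * (tr_n x \<sigma> + dn * 0))"
    using adm[OF \<sigma>] neq by (simp add: admissible_def relaxed_constraints_def)
  then have ev1: "\<forall>\<^sub>F u in small_step \<sigma>. tr_z x (fst u) + snd u <
      sqrt (s12 p (fst u) * tr_b x (fst u) * (tr_n x (fst u) + dn * snd u))"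
    by (rule tendsto_eventually_less[rotated 2]) (intro tendsto_intros pw snd0)+
  have "sqrt (tr_n x \<sigma>) < n_EMmax p / i_g p"
    using speed \<sigma> d by (simp add: pos_less_divide_eq mult.commute)
  then have "(sqrt (tr_n x \<sigma>))\<^sup>2 < (n_EMmax p / i_g p)\<^sup>2"
    using n_pos[OF \<sigma>] by (intro power_strict_mono) auto
  then have "tr_n x \<sigma> + dn * 0 < (n_EMmax p / i_g p)\<^sup>2"
    using n_pos[OF \<sigma>] by simp
  then have ev2: "\<forall>\<^sub>F u in small_step \<sigma>. tr_n x (fst u) + dn * snd u < (n_EMmax p / i_g p)\<^sup>2"
    by (rule tendsto_eventually_less[rotated 2]) (intro tendsto_intros pw snd0)+
  have Q: "Q_p p x \<sigma> < Q_EMmax p * eta_g p * i_g p"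
    using torque \<sigma> d by (simp add: pos_divide_less_eq mult_ac)
  have ev3: "\<forall>\<^sub>F u in small_step \<sigma>.
      Q_p p (vary x (\<lambda>_. snd u) 0 1 dn 0) (fst u) < Q_EMmax p * eta_g p * i_g p"
  proof (rule tendsto_eventually_less[OF _ tendsto_const Q])
    have "((\<lambda>u. Q_p p (vary x (\<lambda>_. snd u) 0 1 dn 0) (fst u)) \<longlongrightarrow>
       - (a_Q2 p * rho p * D_p p ^ 3 * (1 - f_w p) ^ 2) * s12 p \<sigma> * tr_b x \<sigma>
       - (a_Q1 p * rho p * D_p p ^ 4 * (1 - f_w p)) * (tr_z x \<sigma> + 1 * 0)
       + (a_Q0 p * rho p * D_p p ^ 5) * (tr_n x \<sigma> + dn * 0)) (small_step \<sigma>)"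
      unfolding Q_p_def vary_simps by (intro tendsto_intros pw snd0)
    then show "((\<lambda>u. Q_p p (vary x (\<lambda>_. snd u) 0 1 dn 0) (fst u)) \<longlongrightarrow> Q_p p x \<sigma>) (small_step \<sigma>)"
      by (simp add: Q_p_def)
  qed
  have "\<forall>\<^sub>F u in small_step \<sigma>. admissible p (vary x (\<lambda>_. snd u) 0 1 dn 0) (fst u)"
    using ev1 ev2 ev3 eventually_small_step[OF \<sigma>]
  proof eventually_elim
    case (elim u)
    then have t: "fst u \<in> {0..1}" by simp
    let ?v = "vary x (\<lambda>_. snd u) 0 1 dn 0"
    have "F_dEp p ?v (fst u) < F_dEp p x (fst u)"
      using elim z_pos[OF t] n_pos[OF t] by (intro F_less) auto
    then have "F_EM p ?v (fst u) \<le> F_EM p x (fst u)"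
      using eta by (simp add: F_EM_def divide_right_mono)
    moreover from this have "real (k_p p) * (F_dEp p ?v (fst u) / eta_EM_tilde p)
        \<le> real (k_p p) * (F_dEp p x (fst u) / eta_EM_tilde p)"
      unfolding F_EM_def by (intro mult_left_mono) auto
    ultimately show ?case
      using adm[OF t] elim
      by (auto simp: admissible_def positivity_def relaxed_constraints_def powertrain_limits_def F_battd_def)
  qed
  then obtain \<phi> \<tau> where \<phi>: "continuous_on UNIV \<phi>" "\<And>t. 0 \<le> \<phi> t" "\<tau> \<in> {0..1}" "0 < \<phi> \<tau>"
    and x': "feasible p (vary x \<phi> 0 1 dn 0)"
    by (rule feasible_bump[OF x thrust \<sigma>]) blast
  let ?v = "vary x \<phi> 0 1 dn 0"
  \<comment> \<open>The variation leaves the cost unchanged, so it is optimal too, but its energy balance is slack at \<open>\<tau>\<close>.\<close>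
  have "cost p ?v = cost p x" by (simp add: cost_def)
  then have "optimal p ?v" using x' opt by (simp add: optimal_def)
  \<comment> \<open>Both balances are equalities at \<open>\<tau>\<close>, and all their terms
    except the propeller energy agree.\<close>
  then have "real (k_p p) * (F_dEp p ?v \<tau> / eta_EM_tilde p) = real (k_p p) * (F_dEp p x \<tau> / eta_EM_tilde p)"
    using energy_balance_tight[OF data _ _ \<phi>(3), of ?v] energy_balance_tight[OF data opt converter \<phi>(3)]
      converter
    unfolding F_battd_def vary_simps by simp argo
  then have "F_dEp p ?v \<tau> = F_dEp p x \<tau>" using d eta by simp
  moreover have "F_dEp p ?v \<tau> < F_dEp p x \<tau>"
    using z_pos n_pos \<phi> by (intro F_less) auto
  ultimately show False by simp
qed

text \<open>Where \<open>dissipation\<close> is an equality with positive auxiliary load, every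
  decrease of \<open>y\<close> at fixed battery force strictly raises the energy demand. The
  additional hypothesis \<open>dissipation_borderline\<close> leaves room for \<open>F_c\<close> to
  rise and cover it there.\<close>

theorem proposition1:
  fixes p :: vessel and x :: trajectory
  assumes data: "vessel_data p"
    and opt: "optimal p x"
    and propeller: "1 < a_Q1 p * a_T0 p / (a_Q0 p * a_T1 p)
                      - a_Q2 p * (a_T0 p)\<^sup>2 / (a_Q0 p * (a_T1 p)\<^sup>2)"
    and dissipation: "\<forall>\<sigma>\<in>{0..1}. P_battd p (tr_Fb x \<sigma> / tr_y x \<sigma>) \<le> P_aux p"
    and dissipation_borderline:
      "\<forall>\<sigma>\<in>{0..1}. 0 < P_aux p \<and> P_battd p (tr_Fb x \<sigma> / tr_y x \<sigma>) = P_aux p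
                     \<longrightarrow> tr_Fc x \<sigma> < Phi p (P_cmax p) x \<sigma>"
    and speed: "\<forall>\<sigma>\<in>{0..1}. i_g p * sqrt (tr_n x \<sigma>) < n_EMmax p"
    and torque: "\<forall>\<sigma>\<in>{0..1}. Q_p p x \<sigma> / (eta_g p * i_g p) < Q_EMmax p"
    and converter: "\<forall>\<sigma>\<in>{0..1}. tr_Fc x \<sigma> > 0"
  shows "\<forall>\<sigma>\<in>{0..1}.
           tr_y x \<sigma> = 1 / sqrt (tr_b x \<sigma>) \<and>
           tr_z x \<sigma> = sqrt (s12 p \<sigma> * tr_b x \<sigma> * tr_n x \<sigma>) \<and>
           real (k_c p \<sigma>) * tr_Fc x \<sigma> + tr_Fb x \<sigma> * eta_DCDC p =
             real (k_p p) * (F_dEp p x \<sigma> / eta_EM_tilde p) + P_aux p * tr_y x \<sigma> + F_battd p x \<sigma>"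
  using inverse_speed_tight[OF data opt dissipation dissipation_borderline]
    speed_product_tight[OF data opt propeller speed torque converter]
    energy_balance_tight[OF data opt converter]
  by blast

end
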